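(* Let $A,B$ be simple graphs of orders $a,b\ge2$, respectively. Then $$Q(A\vee B)\ge Q(K_{a,b})\,\eta_b^{\,e(A)}\,\eta_a^{\,e(B)}.$$ When $a,b\ge5$, one further has $$Q(A\vee B)\ge Q(K_{a,b})\left(\frac{50}{49}\right)^{e(A)+e(B)}.$$ In this case ($a,b\ge5$), $Q(A\vee B)\ge Q(K_{a,b})$, with equality if and only if both $A$ and $B$ are empty graphs (graphs with no edges).
   Context: All graphs are finite and simple; $e(G)$ denotes the number of edges of $G$, and the order of a graph is its number of vertices. For a graph $G$, $\alpha(G)$ is the number of acyclic orientations of $G$ and $\alpha^{*}(G)$ is the number of totally cyclic orientations of $G$ (orientations in which every edge lies on a directed cycle). For a connected graph $G$, $\tau(G)$ is the number of spanning trees of $G$. For connected $G$, define $Q(G)=\alpha(G)\alpha^{*}(G)/\tau(G)^2$. The join $A\vee B$ is obtained from the disjoint union of $A$ and $B$ by adding all edges between $V(A)$ and $V(B)$. $K_{a,b}$ is the complete bipartite graph with parts of sizes $a$ and $b$. For an integer $s\ge 2$, $\eta_s=2s^2/(s+2)^2$. *)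

theory Defs
  imports Complex_Main "Graph_Theory.Graph_Theory"
begin

text \<open>
  A finite simple graph is a \<^locale>\<open>pair_graph\<close>: a finite loop-free digraph whose arc relation
  is symmetric. An undirected edge thus appears as two opposite arcs.
\<close>

definition edges :: "'a pair_pre_digraph \<Rightarrow> 'a set set" where
  "edges G = {{u, v} | u v. (u, v) \<in> parcs G}"

definition num_edges :: "'a pair_pre_digraph \<Rightarrow> nat" where
  "num_edges G = card (edges G)"

definition orientations :: "'a pair_pre_digraph \<Rightarrow> 'a pair_pre_digraph set" where
  "orientations G = {D. pverts D = pverts G \<and> parcs D \<subseteq> parcs G \<and>
     (\<forall>(u, v) \<in> parcs G. ((u, v) \<in> parcs D) \<noteq> ((v, u) \<in> parcs D))}"

definition acyclic_orientations :: "'a pair_pre_digraph \<Rightarrow> 'a pair_pre_digraph set" where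
  "acyclic_orientations G = {D \<in> orientations G. \<not> (\<exists>p. pre_digraph.cycle (with_proj D) p)}"

definition totally_cyclic_orientations :: "'a pair_pre_digraph \<Rightarrow> 'a pair_pre_digraph set" where
  "totally_cyclic_orientations G = {D \<in> orientations G.
     \<forall>e \<in> parcs D. \<exists>p. pre_digraph.cycle (with_proj D) p \<and> e \<in> set p}"

text \<open>
  The predicate \<^const>\<open>tree\<close> of the library forbids all directed cycles, including the cycle
  \<open>u, v, u\<close> that every edge of a symmetric digraph gives rise to, so it does not describe
  undirected trees. In a symmetric loop-free digraph the cycles of the underlying undirected
  graph are the directed cycles of length at least 3.
\<close>

definition spanning_trees :: "'a pair_pre_digraph \<Rightarrow> 'a pair_pre_digraph set" where
  "spanning_trees G = {T. pair_graph T \<and> spanning (with_proj T) (with_proj G) \<and>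
     connected (with_proj T) \<and> \<not> (\<exists>p. pre_digraph.cycle (with_proj T) p \<and> 3 \<le> length p)}"

definition num_acyclic :: "'a pair_pre_digraph \<Rightarrow> nat" where
  "num_acyclic G = card (acyclic_orientations G)"

definition num_totally_cyclic :: "'a pair_pre_digraph \<Rightarrow> nat" where
  "num_totally_cyclic G = card (totally_cyclic_orientations G)"

definition num_spanning_trees :: "'a pair_pre_digraph \<Rightarrow> nat" where
  "num_spanning_trees G = card (spanning_trees G)"

text \<open>Meaningful for connected \<open>G\<close> only; otherwise the denominator is 0.\<close>

definition Q :: "'a pair_pre_digraph \<Rightarrow> real" where
  "Q G = real (num_acyclic G) * real (num_totally_cyclic G) / (real (num_spanning_trees G))\<^sup>2"

definition join :: "'a pair_pre_digraph \<Rightarrow> 'b pair_pre_digraph \<Rightarrow> ('a + 'b) pair_pre_digraph" where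
  "join A B = \<lparr> pverts = pverts A <+> pverts B,
     parcs = map_prod Inl Inl ` parcs A \<union> map_prod Inr Inr ` parcs B
       \<union> (Inl ` pverts A) \<times> (Inr ` pverts B) \<union> (Inr ` pverts B) \<times> (Inl ` pverts A) \<rparr>"

definition complete_bipartite :: "nat \<Rightarrow> nat \<Rightarrow> (nat + nat) pair_pre_digraph" where
  "complete_bipartite a b = \<lparr> pverts = {..<a} <+> {..<b},
     parcs = (Inl ` {..<a}) \<times> (Inr ` {..<b}) \<union> (Inr ` {..<b}) \<times> (Inl ` {..<a}) \<rparr>"

definition eta :: "nat \<Rightarrow> real" where
  "eta s = 2 * (real s)\<^sup>2 / (real s + 2)\<^sup>2"

lemma complete_bipartite_digraph_complete_bipartite:
  "complete_bipartite_digraph a b (with_proj (complete_bipartite a b))"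
  unfolding complete_bipartite_digraph_pair_def
proof (intro conjI exI)
  let ?K = "complete_bipartite a b" and ?U = "Inl ` {..<a}" and ?V = "Inr ` {..<b}"
  show "finite (pverts ?K)" "pverts ?K = ?U \<union> ?V" "parcs ?K = ?U \<times> ?V \<union> ?V \<times> ?U"
    by (simp_all add: complete_bipartite_def Plus_def)
  show "?U \<inter> ?V = {}" by blast
  show "card ?U = a" "card ?V = b" by (simp_all add: card_image)
qed

lemma pair_graph_join:
  assumes "pair_graph A" "pair_graph B"
  shows "pair_graph (join A B)"
proof -
  interpret A: pair_graph A by fact
  interpret B: pair_graph B by fact
  show ?thesis
  proof unfold_locales
    show "finite (pverts (join A B))" "finite (parcs (join A B))"
      by (simp_all add: join_def A.pair_finite_verts A.pair_finite_arcs
          B.pair_finite_verts B.pair_finite_arcs)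
    show "symmetric (with_proj (join A B))"
      unfolding symmetric_def with_proj_simps
    proof (rule symI)
      fix x y
      assume "(x, y) \<in> parcs (join A B)"
      then show "(y, x) \<in> parcs (join A B)"
        using A.sym_arcs B.sym_arcs
        by (cases x; cases y) (auto simp: join_def symmetric_def sym_def map_prod_def)
    qed
    fix e
    assume "e \<in> parcs (join A B)"
    then show "fst e \<in> pverts (join A B)" "snd e \<in> pverts (join A B)" "fst e \<noteq> snd e"
      using A.pair_no_loops B.pair_no_loops
      by (auto simp: join_def dest: A.wellformed' B.wellformed')
  qed
qed

lemma connected_join:
  assumes "pair_graph A" "pair_graph B" "pverts A \<noteq> {}" "pverts B \<noteq> {}"
  shows "connected (with_proj (join A B))"
proof -
  interpret J: pair_graph "join A B" using assms by (simp add: pair_graph_join)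
  obtain x y where x: "x \<in> pverts A" and y: "y \<in> pverts B" using assms by blast
  have to: "u \<rightarrow>\<^sup>*\<^bsub>with_proj (join A B)\<^esub> Inl x" if "u \<in> pverts (join A B)" for u
  proof (cases u)
    case (Inl w)
    then have "(u, Inr y) \<in> parcs (join A B)" "(Inr y, Inl x) \<in> parcs (join A B)"
      using that x y by (auto simp: join_def)
    then show ?thesis by (meson J.reachable_adjI J.reachable_trans)
  next
    case (Inr w)
    then have "(u, Inl x) \<in> parcs (join A B)"
      using that x by (auto simp: join_def)
    then show ?thesis by (rule J.reachable_adjI)
  qed
  have "Inl x \<rightarrow>\<^sup>*\<^bsub>with_proj (join A B)\<^esub> u" if "u \<in> pverts (join A B)" for u
    by (rule symmetric_reachable[OF J.sym_arcs to[OF that]])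
  with to have "u \<rightarrow>\<^sup>*\<^bsub>with_proj (join A B)\<^esub> v"
    if "u \<in> pverts (join A B)" "v \<in> pverts (join A B)" for u v
    using that J.reachable_trans by blast
  moreover have "pverts (join A B) \<noteq> {}"
    using x by (auto simp: join_def)
  ultimately have "strongly_connected (with_proj (join A B))"
    by (simp add: strongly_connected_def)
  then show ?thesis
    by (simp add: Digraph_Component.connected_def strongly_connected_def
        J.reachable_mk_symmetric_eq[OF J.sym_arcs])
qed

lemma finite_spanning_subgraphs:
  fixes G :: "'a pair_pre_digraph"
  assumes "pair_graph G"
  shows "finite {D :: 'a pair_pre_digraph. pverts D = pverts G \<and> parcs D \<subseteq> parcs G}"
proof -
  interpret pair_graph G by fact
  have "{D :: 'a pair_pre_digraph. pverts D = pverts G \<and> parcs D \<subseteq> parcs G}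
    \<subseteq> (\<lambda>R. \<lparr> pverts = pverts G, parcs = R \<rparr>) ` Pow (parcs G)"
  proof
    fix D :: "'a pair_pre_digraph"
    assume "D \<in> {D. pverts D = pverts G \<and> parcs D \<subseteq> parcs G}"
    then show "D \<in> (\<lambda>R. \<lparr> pverts = pverts G, parcs = R \<rparr>) ` Pow (parcs G)"
      by (intro image_eqI[of _ _ "parcs D"]) auto
  qed
  then show ?thesis
    using pair_finite_arcs by (blast intro: finite_subset)
qed

lemma finite_orientations: "pair_graph G \<Longrightarrow> finite (orientations G)"
  by (rule finite_subset[OF _ finite_spanning_subgraphs]) (auto simp: orientations_def)

lemma finite_spanning_trees: "pair_graph G \<Longrightarrow> finite (spanning_trees G)"
  by (rule finite_subset[OF _ finite_spanning_subgraphs])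
    (auto simp: spanning_trees_def spanning_def subgraph_def)

end

theory Submission
  imports Defs
begin

text \<open>
  The join arises from the complete bipartite graph by adding the edges of \<open>A\<close> and of \<open>B\<close> one at a
  time, and a single new edge \<open>uv\<close> whose ends have \<open>s \<ge> 1\<close> common neighbours multiplies \<open>Q\<close> by at least
  \<open>eta s\<close>. The ends of an edge of \<open>A\<close> have all \<open>b\<close> vertices of \<open>B\<close> as common neighbours, and
  conversely, which gives the two powers of \<open>eta\<close>.

  For a single edge there are three estimates.
  An acyclic orientation extends to the new edge, since at most one of its two directions closes a
  directed cycle; so the number of acyclic orientations does not drop
  (\<open>card_acyc_orients_add_edge\<close>).
  In a totally cyclic orientation the ends of every edge reach each other, hence so do \<open>u\<close> and \<open>v\<close>,
  and the new edge may point either way; so the number of totally cyclic orientations at least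
  doubles (\<open>card_totcyc_orients_add_edge\<close>).
  Finally, the number \<open>t\<close> of spanning trees grows at most to \<open>(1 + 2 / s) t\<close>
  (\<open>card_span_trees_add_edge\<close>).
  This is the bound \<open>2 / s\<close> on the effective resistance between \<open>u\<close> and \<open>v\<close>, proved
  by an exchange: if \<open>T\<close> is a spanning tree through \<open>uv\<close> and \<open>w\<close> is a common neighbour, then \<open>w\<close> lies on
  one side of \<open>T - uv\<close>, and joining it to the end on the other side gives a spanning tree of the old
  graph. The side and the new tree determine \<open>T\<close> and \<open>w\<close>, so there are at most \<open>2 t\<close> pairs
  \<open>(T, w)\<close>. Together, \<open>Q\<close> grows by a factor of at least \<open>2 / (1 + 2 / s)\<^sup>2 = eta s\<close>.

  For \<open>s \<ge> 5\<close> this factor is at least \<open>50 / 49 > 1\<close>, so every edge of \<open>A\<close> or \<open>B\<close> makes \<open>Q\<close> strictly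
  larger as soon as \<open>Q\<close> of the complete bipartite graph is positive
  (\<open>Q_rel_cross_arcs_pos\<close>). Without edges in \<open>A\<close> and \<open>B\<close> the join is isomorphic to that graph.

  The whole argument only concerns reachability, so it is carried out for symmetric relations; the
  notions defined by directed cycles are translated once (\<open>Q_eq_Q_rel\<close>).
\<close>

section \<open>Orientations and spanning trees of symmetric relations\<close>

abbreviation arc_pair :: "'a \<Rightarrow> 'a \<Rightarrow> 'a rel" where
  "arc_pair x y \<equiv> {(x, y), (y, x)}"

definition orientation_of :: "'a rel \<Rightarrow> 'a rel \<Rightarrow> bool" where
  "orientation_of E D \<longleftrightarrow> D \<subseteq> E \<and> (\<forall>(x, y) \<in> E. ((x, y) \<in> D) \<noteq> ((y, x) \<in> D))"

text \<open>
  An orientation is acyclic if no arc can be undone by a directed path, and totally cyclic if every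
  arc can. Phrasing both through the reflexive transitive closure lets them be transported along
  isomorphisms by the same argument.
\<close>

definition acyc_orients :: "'a rel \<Rightarrow> 'a rel set" where
  "acyc_orients E = {D. orientation_of E D \<and> (\<forall>(x, y) \<in> D. (y, x) \<notin> D\<^sup>*)}"

definition totcyc_orients :: "'a rel \<Rightarrow> 'a rel set" where
  "totcyc_orients E = {D. orientation_of E D \<and> (\<forall>(x, y) \<in> D. (y, x) \<in> D\<^sup>*)}"

text \<open>
  A connected graph is a tree iff each edge is a bridge: removing it separates its ends. This avoids
  any mention of cycles.
\<close>

definition span_trees :: "'a set \<Rightarrow> 'a rel \<Rightarrow> 'a rel set" where
  "span_trees V E = {R. R \<subseteq> E \<and> sym R \<and> V \<times> V \<subseteq> R\<^sup>* \<and>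
     (\<forall>(x, y) \<in> R. (x, y) \<notin> (R - arc_pair x y)\<^sup>*)}"

definition Q_rel :: "'a set \<Rightarrow> 'a rel \<Rightarrow> real" where
  "Q_rel V E = real (card (acyc_orients E)) * real (card (totcyc_orients E)) / (real (card (span_trees V E)))\<^sup>2"

lemma acyc_orients_iff_acyclic: "D \<in> acyc_orients E \<longleftrightarrow> orientation_of E D \<and> acyclic D"
proof -
  have "(\<forall>(x, y) \<in> D. (y, x) \<notin> D\<^sup>*) \<longleftrightarrow> acyclic D"
    unfolding acyclic_def by (auto dest: rtrancl_into_trancl2 tranclD)
  then show ?thesis by (simp add: acyc_orients_def)
qed

lemma acyc_orients_subset_Pow: "acyc_orients E \<subseteq> Pow E"
  and totcyc_orients_subset_Pow: "totcyc_orients E \<subseteq> Pow E"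
  and span_trees_subset_Pow: "span_trees V E \<subseteq> Pow E"
  by (auto simp: acyc_orients_def totcyc_orients_def span_trees_def orientation_of_def)

lemma finite_acyc_orients: "finite E \<Longrightarrow> finite (acyc_orients E)"
  and finite_totcyc_orients: "finite E \<Longrightarrow> finite (totcyc_orients E)"
  and finite_span_trees: "finite E \<Longrightarrow> finite (span_trees V E)"
  using acyc_orients_subset_Pow totcyc_orients_subset_Pow span_trees_subset_Pow
  by (metis finite_subset finite_Pow_iff)+

lemma orientation_of_insert:
  assumes "orientation_of E D" "u \<noteq> v" "(u, v) \<notin> E" "(v, u) \<notin> E"
  shows "orientation_of (E \<union> arc_pair u v) (insert (u, v) D)"
  using assms by (auto simp: orientation_of_def)

section \<open>Adding edges with many common neighbours\<close>

text \<open>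
  If \<open>v\<close> reaches \<open>u\<close>, the new edge must be directed from \<open>v\<close> to \<open>u\<close>; otherwise directing it from
  \<open>u\<close> to \<open>v\<close> closes no cycle.
\<close>

lemma card_acyc_orients_add_edge:
  assumes "finite E" "u \<noteq> v" "(u, v) \<notin> E" "(v, u) \<notin> E"
  shows "card (acyc_orients E) \<le> card (acyc_orients (E \<union> arc_pair u v))"
proof (rule card_inj_on_le)
  let ?f = "\<lambda>D. if (v, u) \<in> D\<^sup>* then insert (v, u) D else insert (u, v) D"
  show "inj_on ?f (acyc_orients E)"
  proof (rule inj_on_inverseI[where g = "\<lambda>D. D - arc_pair u v"])
    fix D assume "D \<in> acyc_orients E"
    then have "D \<subseteq> E" using acyc_orients_subset_Pow by blast
    then show "?f D - arc_pair u v = D" using assms by auto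
  qed
  show "?f ` acyc_orients E \<subseteq> acyc_orients (E \<union> arc_pair u v)"
  proof safe
    fix D assume D: "D \<in> acyc_orients E"
    then have or: "orientation_of E D" and ac: "acyclic D" by (auto simp: acyc_orients_iff_acyclic)
    have "(u, v) \<notin> D\<^sup>* \<or> (v, u) \<notin> D\<^sup>*"
      using ac acyclic_impl_antisym_rtrancl assms(2) by (metis antisymD)
    then show "?f D \<in> acyc_orients (E \<union> arc_pair u v)"
      using orientation_of_insert[OF or assms(2-4)]
        orientation_of_insert[OF or, of v u] assms(2-4) ac
      by (auto simp: acyc_orients_iff_acyclic insert_commute)
  qed
  show "finite (acyc_orients (E \<union> arc_pair u v))" using assms(1) by (simp add: finite_acyc_orients)
qed

text \<open>
  An arc of a totally cyclic orientation can be travelled backwards along the rest of its cycle, so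
  orienting the edges loses no reachability.
\<close>

lemma totcyc_orients_reach:
  assumes "D \<in> totcyc_orients E"
  shows "E\<^sup>* \<subseteq> D\<^sup>*"
proof -
  have "E \<subseteq> D\<^sup>*"
    using assms unfolding totcyc_orients_def orientation_of_def by fast
  then show ?thesis by (metis rtrancl_idemp rtrancl_mono)
qed

text \<open>
  Both directions of the new edge lie on a directed cycle, because its ends already reach each
  other in both ways.
\<close>

lemma card_totcyc_orients_add_edge:
  assumes "finite E" "u \<noteq> v" "(u, v) \<notin> E" "(v, u) \<notin> E"
    and uv: "(u, v) \<in> E\<^sup>*" "(v, u) \<in> E\<^sup>*"
  shows "2 * card (totcyc_orients E) \<le> card (totcyc_orients (E \<union> arc_pair u v))"
proof -
  have sub: "insert (x, y) ` totcyc_orients E \<subseteq> totcyc_orients (E \<union> arc_pair u v)"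
    if xy: "(x, y) \<in> arc_pair u v" for x y
  proof safe
    fix D assume D: "D \<in> totcyc_orients E"
    have "orientation_of (E \<union> arc_pair x y) (insert (x, y) D)"
      using D xy assms(2-4) by (intro orientation_of_insert) (auto simp: totcyc_orients_def)
    moreover have "arc_pair x y = arc_pair u v" using xy by auto
    moreover have "(q, p) \<in> (insert (x, y) D)\<^sup>*" if "(p, q) \<in> insert (x, y) D" for p q
    proof -
      have "(q, p) \<in> D\<^sup>*"
        using that xy uv totcyc_orients_reach[OF D] D by (auto simp: totcyc_orients_def)
      then show ?thesis using rtrancl_mono[of D "insert (x, y) D"] by auto
    qed
    ultimately show "insert (x, y) D \<in> totcyc_orients (E \<union> arc_pair u v)"
      by (auto simp: totcyc_orients_def)
  qed
  have card: "card (insert (x, y) ` totcyc_orients E) = card (totcyc_orients E)"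
    if "(x, y) \<notin> E" for x y
    using that totcyc_orients_subset_Pow[of E]
    by (intro card_image inj_on_inverseI[where g = "\<lambda>D. D - {(x, y)}"]) auto
  have "insert (u, v) ` totcyc_orients E \<inter> insert (v, u) ` totcyc_orients E = {}"
    using assms(2-4) totcyc_orients_subset_Pow[of E] by auto
  then have "2 * card (totcyc_orients E) = card (insert (u, v) ` totcyc_orients E \<union> insert (v, u) ` totcyc_orients E)"
    using assms(1,3,4) by (simp add: card_Un_disjoint card finite_totcyc_orients)
  also have "\<dots> \<le> card (totcyc_orients (E \<union> arc_pair u v))"
    using sub assms(1) by (intro card_mono finite_totcyc_orients) auto
  finally show ?thesis .
qed

text \<open>
  A path may be assumed to use the added edge at most once, in one of its two directions.
\<close>

lemma rtrancl_add_edge_cases: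
  assumes "(p, q) \<in> (S \<union> arc_pair x y)\<^sup>*" "sym S"
  shows "(p, q) \<in> S\<^sup>* \<or> (p, x) \<in> S\<^sup>* \<and> (y, q) \<in> S\<^sup>* \<or> (p, y) \<in> S\<^sup>* \<and> (x, q) \<in> S\<^sup>*"
  using assms(1)
proof (induction rule: rtrancl_induct)
  case base
  then show ?case by simp
next
  case (step q r)
  have "sym (S\<^sup>*)" using assms(2) by (rule sym_rtrancl)
  then show ?case using step by (auto intro: rtrancl_into_rtrancl)
qed

text \<open>
  Removing \<open>uv\<close> from a tree leaves the component \<open>F\<^sub>u\<close> of \<open>u\<close> and the component \<open>F\<^sub>v\<close> of \<open>v\<close>; any edge
  between the two makes a tree again. An edge of \<open>F\<close> stays a bridge: a path avoiding it would
  have to cross the new edge \<open>xy\<close>, and then \<open>x\<close> and \<open>y\<close> would already be connected in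
  \<open>F\<close> by way of the edge itself.
\<close>

lemma span_tree_exchange:
  assumes T: "T \<in> span_trees V (E \<union> arc_pair u v)" "(u, v) \<in> T"
    and F: "F = T - arc_pair u v"
    and "sym E" and xy: "(x, y) \<in> E" "(u, x) \<in> F\<^sup>*" "(v, y) \<in> F\<^sup>*"
  shows "F \<union> arc_pair x y \<in> span_trees V E"
proof -
  let ?R = "F \<union> arc_pair x y"
  have symT: "sym T" and VT: "V \<times> V \<subseteq> T\<^sup>*" and bridge: "\<And>p q. (p, q) \<in> T \<Longrightarrow> (p, q) \<notin> (T - arc_pair p q)\<^sup>*"
    using T(1) by (auto simp: span_trees_def)
  have symF: "sym F" using symT unfolding F sym_def by blast
  then have symFs: "sym (F\<^sup>*)" by (rule sym_rtrancl)
  have uvF: "(u, v) \<notin> F\<^sup>*" using bridge[OF T(2)] F by simp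
  have xyF: "(x, y) \<notin> F\<^sup>*"
    using uvF xy symFs by (meson rtrancl_trans symD)
  have "(u, v) \<in> ?R\<^sup>*"
  proof -
    have "F\<^sup>* \<subseteq> ?R\<^sup>*" by (intro rtrancl_mono) auto
    then have "(u, x) \<in> ?R\<^sup>*" "(y, v) \<in> ?R\<^sup>*" using xy symFs by (auto dest: symD)
    then show ?thesis by (meson UnCI insertI1 r_into_rtrancl rtrancl_trans)
  qed
  moreover have symR: "sym ?R" using symF by (auto simp: sym_def)
  ultimately have "T \<subseteq> ?R\<^sup>*"
    using F by (auto dest: symD[OF sym_rtrancl])
  then have "T\<^sup>* \<subseteq> ?R\<^sup>*" by (metis rtrancl_idemp rtrancl_mono)
  then have "V \<times> V \<subseteq> ?R\<^sup>*" using VT by blast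
  moreover have "?R \<subseteq> E" using T(1) xy(1) \<open>sym E\<close> by (auto simp: F span_trees_def dest: symD)
  moreover have "(p, q) \<notin> (?R - arc_pair p q)\<^sup>*" if pq: "(p, q) \<in> ?R" for p q
  proof (cases "(p, q) \<in> F")
    case False
    then have "arc_pair p q = arc_pair x y" using pq by auto
    then have "?R - arc_pair p q \<subseteq> F" by auto
    then have "(?R - arc_pair p q)\<^sup>* \<subseteq> F\<^sup>*" by (rule rtrancl_mono)
    moreover have "(p, q) \<notin> F\<^sup>*" using False pq xyF symFs by (auto dest: symD)
    ultimately show ?thesis by blast
  next
    case True
    let ?S = "F - arc_pair p q"
    have symS: "sym ?S" using symF unfolding sym_def by blast
    show ?thesis
    proof
      assume "(p, q) \<in> (?R - arc_pair p q)\<^sup>*"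
      moreover have "?R - arc_pair p q \<subseteq> ?S \<union> arc_pair x y" by blast
      ultimately have "(p, q) \<in> (?S \<union> arc_pair x y)\<^sup>*" by (meson rtrancl_mono subsetD)
      note rtrancl_add_edge_cases[OF this symS]
      moreover have "(p, q) \<notin> ?S\<^sup>*"
      proof
        assume "(p, q) \<in> ?S\<^sup>*"
        moreover have "?S\<^sup>* \<subseteq> (T - arc_pair p q)\<^sup>*" unfolding F by (intro rtrancl_mono) blast
        ultimately show False using bridge[of p q] True F by blast
      qed
      moreover have "?S\<^sup>* \<subseteq> F\<^sup>*" by (intro rtrancl_mono) blast
      ultimately have "(p, x) \<in> F\<^sup>* \<and> (y, q) \<in> F\<^sup>* \<or> (p, y) \<in> F\<^sup>* \<and> (x, q) \<in> F\<^sup>*"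
        by blast
      moreover have "(p, q) \<in> F\<^sup>*" using True by blast
      ultimately have "(x, y) \<in> F\<^sup>*"
        using symFs by (meson rtrancl_trans symD)
      then show False using xyF by simp
    qed
  qed
  ultimately show ?thesis using symR unfolding span_trees_def by blast
qed

text \<open>
  The vertex joined to \<open>v\<close> can be read off from the tree: it is the neighbour of \<open>v\<close> on the path
  from \<open>u\<close> to \<open>v\<close>. Instead of the path, the proof uses that if \<open>w1\<close> and \<open>w2\<close> differed, the
  edge \<open>w2 v\<close> would belong to \<open>F1\<close>, and the path from \<open>u\<close> to \<open>w2\<close> in \<open>F2\<close>, which cannot pass
  through \<open>v\<close>, would survive in \<open>F1\<close> and connect \<open>u\<close> with \<open>v\<close> there.
\<close>

lemma span_tree_exchange_inj:
  assumes eq: "F1 \<union> arc_pair w1 v = F2 \<union> arc_pair w2 v"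
    and "sym F1" "sym F2"
    and sep: "(u, v) \<notin> F1\<^sup>*" "(u, v) \<notin> F2\<^sup>*"
    and side: "(u, w1) \<in> F1\<^sup>*" "(u, w2) \<in> F2\<^sup>*"
  shows "w1 = w2 \<and> F1 = F2"
proof -
  have symFs: "sym (F1\<^sup>*)" "sym (F2\<^sup>*)" using assms by (simp_all add: sym_rtrancl)
  have new: "(w1, v) \<notin> F1" "(v, w1) \<notin> F1" "(w2, v) \<notin> F2" "(v, w2) \<notin> F2"
    using assms by (meson rtrancl.rtrancl_into_rtrancl symD)+
  have ne: "w1 \<noteq> v" "w2 \<noteq> v" using sep side by auto
  have "w1 = w2"
  proof (rule ccontr)
    assume neq: "w1 \<noteq> w2"
    let ?S = "F2 - arc_pair w1 v"
    have symS: "sym ?S" using \<open>sym F2\<close> unfolding sym_def by blast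
    have S1: "?S\<^sup>* \<subseteq> F1\<^sup>*" using eq new by (intro rtrancl_mono) blast
    have S2: "?S\<^sup>* \<subseteq> F2\<^sup>*" by (intro rtrancl_mono) blast
    have "F2 \<subseteq> ?S \<union> arc_pair w1 v" by blast
    then have "(u, w2) \<in> (?S \<union> arc_pair w1 v)\<^sup>*" using side(2) by (meson rtrancl_mono subsetD)
    note rtrancl_add_edge_cases[OF this symS]
    then have "(u, w2) \<in> F1\<^sup>* \<or> (v, w2) \<in> F2\<^sup>* \<or> (u, v) \<in> F2\<^sup>*"
      using S1 S2 by blast
    moreover have "(w2, v) \<in> F1" using eq neq ne by blast
    ultimately show False
      using sep side symFs by (meson rtrancl.rtrancl_into_rtrancl rtrancl_trans symD)
  qed
  then show ?thesis using eq new by blast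
qed

text \<open>
  A double count of the pairs \<open>(T, w)\<close> of a spanning tree through \<open>uv\<close> and a common neighbour of
  \<open>u\<close> and \<open>v\<close>: the exchange maps them to spanning trees without \<open>uv\<close>, at most two to one. The
  Boolean records whether \<open>w\<close> is on the side of \<open>u\<close>, which makes the map injective.
\<close>

lemma card_span_trees_add_edge:
  assumes fin: "finite E" and symE: "sym E" and EV: "E \<subseteq> V \<times> V" 
    and uv: "u \<noteq> v" "(u, v) \<notin> E"
    and W: "W = {w. (u, w) \<in> E \<and> (v, w) \<in> E}"
  shows "card W * card (span_trees V (E \<union> arc_pair u v)) \<le> (card W + 2) * card (span_trees V E)"
proof -
  let ?E' = "E \<union> arc_pair u v"
  define N where "N = {T \<in> span_trees V ?E'. (u, v) \<in> T}"
  have vu: "(v, u) \<notin> E" using uv symE by (meson symD)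
  have split: "span_trees V ?E' = span_trees V E \<union> N"
  proof -
    have "T \<subseteq> E" if "T \<in> span_trees V ?E'" "(u, v) \<notin> T" for T
      using that unfolding span_trees_def by (blast dest: symD)
    then show ?thesis by (auto simp: N_def span_trees_def)
  qed
  define F where "F T = T - arc_pair u v" for T :: "'a rel"
  define f where "f = (\<lambda>(T, w). if (u, w) \<in> (F T)\<^sup>* then (F T \<union> arc_pair w v, True)
    else (F T \<union> arc_pair w u, False))"
  have symF: "sym (F T)" if "T \<in> N" for T
  proof -
    have "sym T" using that by (auto simp: N_def span_trees_def)
    then show ?thesis unfolding F_def sym_def by blast
  qed
  have sep: "(u, v) \<notin> (F T)\<^sup>*" if "T \<in> N" for T
    using that by (auto simp: N_def span_trees_def F_def)
  have sides: "(v, w) \<in> (F T)\<^sup>*" if "T \<in> N" "w \<in> W" "(u, w) \<notin> (F T)\<^sup>*" for T w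
  proof -
    have "(u, w) \<in> V \<times> V" using that(2) EV W by auto
    then have "(u, w) \<in> T\<^sup>*" using that(1) by (auto simp: N_def span_trees_def)
    moreover have "T \<subseteq> F T \<union> arc_pair u v" by (auto simp: F_def)
    ultimately have "(u, w) \<in> (F T \<union> arc_pair u v)\<^sup>*" by (meson rtrancl_mono subsetD)
    from rtrancl_add_edge_cases[OF this symF[OF that(1)]] that(3) show ?thesis by blast
  qed
  have "card (N \<times> W) \<le> card (span_trees V E \<times> (UNIV :: bool set))"
  proof (rule card_inj_on_le)
    show "finite (span_trees V E \<times> (UNIV :: bool set))" using fin by (simp add: finite_span_trees)
    show "f ` (N \<times> W) \<subseteq> span_trees V E \<times> UNIV"
    proof safe
      fix T w R b assume TN: "T \<in> N" and w: "w \<in> W" and eq: "(R, b) = f (T, w)"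
      have T: "T \<in> span_trees V ?E'" "(u, v) \<in> T" using TN by (auto simp: N_def)
      have wE: "(w, v) \<in> E" "(u, w) \<in> E" using w W symE by (auto dest: symD)
      show "R \<in> span_trees V E"
      proof (cases "(u, w) \<in> (F T)\<^sup>*")
        case True
        then show ?thesis
          using span_tree_exchange[OF T F_def symE wE(1)] eq by (simp add: f_def)
      next
        case False
        then show ?thesis
          using span_tree_exchange[OF T F_def symE wE(2)] sides[OF TN w] eq
          by (simp add: f_def insert_commute)
      qed
    qed simp
    have FN: "T1 = T2" if "T1 \<in> N" "T2 \<in> N" "F T1 = F T2" for T1 T2
    proof -
      have "T = F T \<union> arc_pair u v" if "T \<in> N" for T
        using that by (auto simp: N_def F_def span_trees_def dest: symD)
      then show ?thesis using that by metis
    qed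
    show "inj_on f (N \<times> W)"
    proof (rule inj_onI, clarify)
      fix T1 w1 T2 w2
      assume N: "T1 \<in> N" "T2 \<in> N" and w: "w1 \<in> W" "w2 \<in> W" and eq: "f (T1, w1) = f (T2, w2)"
      have sep': "(v, u) \<notin> (F T)\<^sup>*" if "T \<in> N" for T
        using sep[OF that] sym_rtrancl[OF symF[OF that]] by (meson symD)
      have "w1 = w2 \<and> F T1 = F T2"
      proof (cases "(u, w1) \<in> (F T1)\<^sup>*")
        case True
        then have 1: "(u, w2) \<in> (F T2)\<^sup>*" and 2: "F T1 \<union> arc_pair w1 v = F T2 \<union> arc_pair w2 v"
          using eq by (auto simp: f_def split: if_splits)
        show ?thesis
          by (rule span_tree_exchange_inj[OF 2 symF symF sep sep True 1]) (use N in auto)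
      next
        case False
        then have 1: "(u, w2) \<notin> (F T2)\<^sup>*" and 2: "F T1 \<union> arc_pair w1 u = F T2 \<union> arc_pair w2 u"
          using eq by (auto simp: f_def split: if_splits)
        show ?thesis
          by (rule span_tree_exchange_inj[OF 2 symF symF sep' sep' sides sides]) (use N w 1 False in auto)
      qed
      then show "T1 = T2 \<and> w1 = w2" using FN N by blast
    qed
  qed
  then have N: "card W * card N \<le> 2 * card (span_trees V E)"
    by (simp add: card_cartesian_product mult.commute)
  have "card (span_trees V ?E') \<le> card (span_trees V E) + card N"
    unfolding split by (rule card_Un_le)
  then have "card W * card (span_trees V ?E') \<le> card W * card (span_trees V E) + card W * card N"
    by (metis add_mult_distrib2 mult_le_mono2)
  then show ?thesis using N by (simp add: add_mult_distrib)
qed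

lemma Q_rel_nonneg: "0 \<le> Q_rel V E"
  by (simp add: Q_rel_def)

lemma eta_nonneg: "0 \<le> eta s"
  by (simp add: eta_def)

text \<open>
  The old tree count \<open>t\<close> may vanish, in which case \<open>Q_rel\<close> is \<open>0\<close> by division by zero and the
  inequality is trivial. Otherwise the three counts combine to the factor
  \<open>1 \<cdot> 2 / ((s + 2) / s)\<^sup>2\<close>.
\<close>

lemma Q_rel_add_edge:
  assumes fin: "finite E" and symE: "sym E" and EV: "E \<subseteq> V \<times> V"
    and uv: "u \<noteq> v" "(u, v) \<notin> E"
    and s: "1 \<le> s" "s \<le> card {w. (u, w) \<in> E \<and> (v, w) \<in> E}"
  shows "Q_rel V E * eta s \<le> Q_rel V (E \<union> arc_pair u v)"
proof (cases "card (span_trees V E) = 0")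
  case True
  then show ?thesis using Q_rel_nonneg by (simp add: Q_rel_def)
next
  case False
  let ?E' = "E \<union> arc_pair u v"
  define W where "W = {w. (u, w) \<in> E \<and> (v, w) \<in> E}"
  define t t' where "t = real (card (span_trees V E))" and "t' = real (card (span_trees V ?E'))"
  have vu: "(v, u) \<notin> E" using uv symE by (meson symD)
  have W: "real s \<le> real (card W)" using s by (simp add: W_def)
  then obtain w where "w \<in> W" using s by fastforce
  then have "(u, w) \<in> E" "(w, v) \<in> E" using symE by (auto simp: W_def dest: symD)
  then have reach: "(u, v) \<in> E\<^sup>*" "(v, u) \<in> E\<^sup>*"
    using symE by (meson r_into_rtrancl rtrancl_into_rtrancl symD)+
  have t: "0 < t" using False by (simp add: t_def)
  have "span_trees V E \<subseteq> span_trees V ?E'" by (auto simp: span_trees_def)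
  then have "t \<le> t'" using fin by (simp add: t_def t'_def card_mono finite_span_trees)
  then have t': "0 < t'" using t by simp
  have "real (card W) * t' \<le> (real (card W) + 2) * t"
    using of_nat_mono[OF card_span_trees_add_edge[OF fin symE EV uv W_def], where 'a = real]
    unfolding t_def t'_def by (simp only: of_nat_mult of_nat_add of_nat_numeral)
  then have "real (card W) * (t' - t) \<le> 2 * t" by (simp add: algebra_simps)
  moreover have "real s * (t' - t) \<le> real (card W) * (t' - t)"
    using W \<open>t \<le> t'\<close> by (intro mult_right_mono) auto
  ultimately have st: "real s * t' \<le> (real s + 2) * t" by (simp add: algebra_simps)
  let ?n = "real (card (acyc_orients E)) * real (card (totcyc_orients E))"
  let ?n' = "real (card (acyc_orients ?E')) * real (card (totcyc_orients ?E'))"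
  have "real (card (acyc_orients E)) * (2 * real (card (totcyc_orients E))) \<le> ?n'"
    using card_acyc_orients_add_edge[OF fin uv vu] card_totcyc_orients_add_edge[OF fin uv vu reach]
    by (intro mult_mono) auto
  then have n: "2 * ?n \<le> ?n'" by simp
  have "(real s * t')\<^sup>2 \<le> ((real s + 2) * t)\<^sup>2"
    using st t' by (intro power_mono) auto
  then have "(real s)\<^sup>2 * t'\<^sup>2 \<le> (real s + 2)\<^sup>2 * t\<^sup>2"
    by (simp only: power_mult_distrib)
  then have sq: "(real s)\<^sup>2 / ((real s + 2)\<^sup>2 * t\<^sup>2) \<le> 1 / t'\<^sup>2"
    using t t' by (simp add: divide_simps mult_ac)
  have "Q_rel V E * eta s = 2 * ?n * ((real s)\<^sup>2 / ((real s + 2)\<^sup>2 * t\<^sup>2))"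
    by (simp add: Q_rel_def eta_def t_def mult_ac)
  also have "\<dots> \<le> ?n' * (1 / t'\<^sup>2)"
    by (rule mult_mono[OF n sq]) auto
  finally show ?thesis by (simp add: Q_rel_def t'_def)
qed

definition edges_of :: "'a rel \<Rightarrow> 'a set set" where
  "edges_of N = (\<lambda>(x, y). {x, y}) ` N"

text \<open>
  Common neighbours are counted in the initial graph \<open>E\<close>; they remain common neighbours
  while further edges are added.
\<close>

lemma Q_rel_add_edges:
  assumes fin: "finite E" and symE: "sym E" and EV: "E \<subseteq> V \<times> V"
    and "finite N" "sym N" "irrefl N" "N \<subseteq> V \<times> V" "E \<inter> N = {}"
    and s: "1 \<le> s" "\<And>x y. (x, y) \<in> N \<Longrightarrow> s \<le> card {w. (x, w) \<in> E \<and> (y, w) \<in> E}"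
  shows "Q_rel V E * eta s ^ card (edges_of N) \<le> Q_rel V (E \<union> N)"
  using assms(4-8) s(2)
proof (induction "card (edges_of N)" arbitrary: N)
  case 0
  then have "N = {}" by (auto simp: edges_of_def)
  then show ?case by (simp add: edges_of_def)
next
  case (Suc n)
  from Suc.hyps(2) have "N \<noteq> {}" by (auto simp: edges_of_def)
  then obtain u v where uv: "(u, v) \<in> N" by auto
  then have vu: "(v, u) \<in> N" using Suc.prems(2) by (meson symD)
  have ne: "u \<noteq> v" using uv Suc.prems(3) by (auto simp: irrefl_def)
  define M where "M = N - arc_pair u v"
  have edges_M: "edges_of M = edges_of N - {{u, v}}"
  proof -
    have image_diff: "f ` {p \<in> N. f p \<noteq> c} = f ` N - {c}" for f :: "'a \<times> 'a \<Rightarrow> 'a set" and c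
      by auto
    have "p \<in> M \<longleftrightarrow> p \<in> N \<and> (\<lambda>(x, y). {x, y}) p \<noteq> {u, v}" for p
      unfolding M_def by (cases p) (simp add: doubleton_eq_iff)
    then have "M = {p \<in> N. (\<lambda>(x, y). {x, y}) p \<noteq> {u, v}}"
      by (intro set_eqI) (simp only: mem_Collect_eq)
    then show ?thesis unfolding edges_of_def by (simp only: image_diff)
  qed
  have "{u, v} \<in> edges_of N" using uv by (force simp: edges_of_def)
  then have card_M: "n = card (edges_of M)"
    using Suc.hyps(2) by (simp add: edges_M)
  have symM: "sym M" using Suc.prems(2) unfolding M_def sym_def by blast
  have NM: "E \<union> N = (E \<union> M) \<union> arc_pair u v" using uv vu by (auto simp: M_def)
  have IH: "Q_rel V E * eta s ^ card (edges_of M) \<le> Q_rel V (E \<union> M)"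
    using Suc.prems symM
    by (intro Suc.hyps(1)[OF card_M]) (auto simp: M_def irrefl_def)
  have finM: "finite M" using Suc.prems by (simp add: M_def)
  have "{w. (u, w) \<in> E \<union> M \<and> (v, w) \<in> E \<union> M} \<subseteq> snd ` (E \<union> M)" by force
  then have "finite {w. (u, w) \<in> E \<union> M \<and> (v, w) \<in> E \<union> M}"
    using fin finM by (meson finite_UnI finite_imageI finite_subset)
  then have "card {w. (u, w) \<in> E \<and> (v, w) \<in> E} \<le> card {w. (u, w) \<in> E \<union> M \<and> (v, w) \<in> E \<union> M}"
    by (intro card_mono) auto
  then have "s \<le> card {w. (u, w) \<in> E \<union> M \<and> (v, w) \<in> E \<union> M}"
    using Suc.prems(6)[OF uv] by simp
  then have "Q_rel V (E \<union> M) * eta s \<le> Q_rel V (E \<union> M \<union> arc_pair u v)"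
    using fin finM symE symM EV Suc.prems ne uv s(1)
    by (intro Q_rel_add_edge) (auto simp: sym_Un M_def)
  moreover have "Q_rel V E * eta s ^ Suc n \<le> Q_rel V (E \<union> M) * eta s"
    using mult_right_mono[OF IH eta_nonneg[of s]] card_M by (simp add: mult_ac)
  ultimately show ?case using Suc.hyps(2) NM by simp
qed

section \<open>From graphs to relations\<close>

text \<open>
  Spanning subgraphs on a fixed vertex set may be counted by their arc sets.
\<close>

lemma card_eq_card_arc_sets:
  assumes "\<And>D :: 'a pair_pre_digraph. D \<in> X \<longleftrightarrow> pverts D = V \<and> parcs D \<in> Y"
  shows "card X = card Y"
proof (rule bij_betw_same_card)
  show "bij_betw parcs X Y"
  proof (rule bij_betwI)
    show "(\<lambda>R. \<lparr>pverts = V, parcs = R\<rparr>) \<in> Y \<rightarrow> X" using assms by auto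
  qed (use assms in auto)
qed

lemma ex_cycle_iff:
  assumes "pair_wf_digraph D"
  shows "(\<exists>p. pre_digraph.cycle (with_proj D) p) \<longleftrightarrow> \<not> acyclic (parcs D)"
proof -
  interpret pair_wf_digraph D by fact
  show ?thesis
  proof
    assume "\<exists>p. cycle p"
    then obtain u p where "awalk u p u" "p \<noteq> []" by (auto simp: cycle_def)
    then have "(u, u) \<in> (parcs D)\<^sup>+" by (rule reachable1_awalkI)
    then show "\<not> acyclic (parcs D)" by (auto simp: acyclic_def)
  next
    assume "\<not> acyclic (parcs D)"
    then obtain u where "(u, u) \<in> (parcs D)\<^sup>+" by (auto simp: acyclic_def)
    then obtain p where "awalk u p u" "p \<noteq> []" by (auto simp: reachable1_awalk)
    then have "closed_w p" by (auto simp: closed_w_def)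
    then show "\<exists>p. cycle p" by (rule closed_w_imp_cycle)
  qed
qed

text \<open>
  A path back from \<open>y\<close> to \<open>x\<close> may be taken without repeated vertices, and then the arc closes it to
  a cycle.
\<close>

lemma arc_on_cycle_iff:
  assumes "pair_wf_digraph D" and xy: "(x, y) \<in> parcs D"
  shows "(\<exists>p. pre_digraph.cycle (with_proj D) p \<and> (x, y) \<in> set p) \<longleftrightarrow> (y, x) \<in> (parcs D)\<^sup>*"
proof -
  interpret pair_wf_digraph D by fact
  have V: "x \<in> pverts D" "y \<in> pverts D" using xy by (auto dest: wellformed')
  show ?thesis
  proof
    assume "\<exists>p. cycle p \<and> (x, y) \<in> set p"
    then obtain u p where p: "awalk u p u" "(x, y) \<in> set p" by (auto simp: cycle_def)
    then obtain p1 p2 where "p = p1 @ (x, y) # p2" by (auto simp: in_set_conv_decomp)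
    then have "awalk u p1 x" "awalk y p2 u" using p(1) by (auto simp: awalk_Cons_iff)
    then show "(y, x) \<in> (parcs D)\<^sup>*"
      using reachable_awalkI reachable_trans reachable_conv'[OF V(2)] by blast
  next
    assume "(y, x) \<in> (parcs D)\<^sup>*"
    then obtain q where "apath y q x" using reachable_conv'[OF V(2)] reachable_apath by blast
    then have "awalk x ((x, y) # q) x" "distinct (tl (awalk_verts x ((x, y) # q)))"
      using xy by (auto simp: apath_def awalk_Cons_iff)
    then have "cycle ((x, y) # q)" unfolding cycle_def by blast
    then show "\<exists>p. cycle p \<and> (x, y) \<in> set p" by (intro exI[of _ "(x, y) # q"]) simp
  qed
qed

lemma pcas_ends_in_pawalk_verts:
  "pcas u p v \<Longrightarrow> (x, y) \<in> set p \<Longrightarrow> x \<in> set (pawalk_verts u p) \<and> y \<in> set (pawalk_verts u p)"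
proof (induction p arbitrary: u)
  case (Cons e p)
  have "snd e \<in> set (pawalk_verts (snd e) p)" by (cases p) (use Cons.prems in auto)
  then show ?case using Cons by auto
qed simp

lemma pcas_last_in_pawalk_verts: "pcas u p v \<Longrightarrow> v \<in> set (pawalk_verts u p)"
  by (induction p arbitrary: u) auto

text \<open>
  A path of length at least 2 is not the arc between its ends, so prepending that arc gives a
  cycle of the undirected graph rather than an edge traversed back and forth.
\<close>

lemma path_avoids_closing_arc:
  assumes "pcas y q x" "distinct (pawalk_verts y q)" "2 \<le> length q"
  shows "set q \<inter> arc_pair x y = {}"
proof -
  obtain z q' where q: "q = (y, z) # q'"
    using assms by (cases q) auto
  then have q': "q' \<noteq> []" using assms(3) by auto
  have cas: "pcas z q' x" and y: "y \<notin> set (pawalk_verts z q')" and dist: "distinct (pawalk_verts z q')"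
    using assms by (auto simp: q)
  obtain t q'' where t: "q' = (z, t) # q''" using q' cas by (cases q') auto
  have "z \<noteq> x" using cas dist pcas_last_in_pawalk_verts[of t q'' x] by (auto simp: t)
  moreover have "z \<noteq> y" using y by (auto simp: t)
  ultimately show ?thesis
    using pcas_ends_in_pawalk_verts[OF cas] y by (auto simp: q)
qed

text \<open>
  A cycle of length at least 3 is an edge together with a path between its ends that does not use this
  edge.
\<close>

lemma ex_undirected_cycle_iff:
  assumes "pair_graph T"
  shows "(\<exists>p. pre_digraph.cycle (with_proj T) p \<and> 3 \<le> length p) \<longleftrightarrow>
    (\<exists>(x, y) \<in> parcs T. (x, y) \<in> (parcs T - arc_pair x y)\<^sup>*)"
proof -
  interpret pair_graph T by fact
  define T' where "T' x y = \<lparr>pverts = pverts T, parcs = parcs T - arc_pair x y\<rparr>" for x y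
  have wf: "pair_wf_digraph (T' x y)" for x y
    by unfold_locales (auto simp: T'_def dest: wellformed')
  have awalk_T': "pre_digraph.awalk (with_proj (T' x y)) a p b \<longleftrightarrow> awalk a p b \<and> set p \<inter> arc_pair x y = {}"
    for a b x y p
    by (auto simp: pre_digraph.awalk_def cas_with_proj_eq T'_def)
  have T'_iff: "(a, b) \<in> (parcs T - arc_pair x y)\<^sup>* \<longleftrightarrow> (\<exists>p. apath a p b \<and> set p \<inter> arc_pair x y = {})"
    if "a \<in> pverts T" for a b x y
  proof -
    interpret S: pair_wf_digraph "T' x y" by (rule wf)
    have "(a, b) \<in> (parcs T - arc_pair x y)\<^sup>* \<longleftrightarrow> (\<exists>p. S.apath a p b)"
      using S.reachable_conv'[of a b] S.reachable_apath[of a b] that by (simp add: T'_def)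
    then show ?thesis
      by (auto simp: S.apath_def apath_def awalk_T')
  qed
  show ?thesis
  proof
    assume "\<exists>p. cycle p \<and> 3 \<le> length p"
    then obtain u p where p: "awalk u p u" "distinct (tl (awalk_verts u p))" "3 \<le> length p"
      by (auto simp: cycle_def)
    then obtain y q where q: "p = (u, y) # q" by (cases p) (auto simp: awalk_Cons_iff)
    have ap: "apath y q u" using p by (auto simp: q awalk_Cons_iff apath_def)
    have uy: "(u, y) \<in> parcs T" using p(1) by (auto simp: q awalk_Cons_iff)
    have "set q \<inter> arc_pair u y = {}"
      using ap p(3) by (intro path_avoids_closing_arc) (auto simp: apath_def awalk_def q)
    then have "\<exists>q. apath y q u \<and> set q \<inter> arc_pair y u = {}"
      using ap by (auto simp: insert_commute)
    then have "(y, u) \<in> (parcs T - arc_pair y u)\<^sup>*"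
      using T'_iff[OF wellformed'(2)[OF uy]] by blast
    then show "\<exists>(x, y) \<in> parcs T. (x, y) \<in> (parcs T - arc_pair x y)\<^sup>*"
      using arcs_symmetric[OF uy] by blast
  next
    assume "\<exists>(x, y) \<in> parcs T. (x, y) \<in> (parcs T - arc_pair x y)\<^sup>*"
    then obtain x y where xy: "(x, y) \<in> parcs T" "(x, y) \<in> (parcs T - arc_pair x y)\<^sup>*" by auto
    then obtain p where p: "apath x p y" "set p \<inter> arc_pair x y = {}"
      using T'_iff wellformed'(1)[OF xy(1)] by blast
    have yx: "(y, x) \<in> parcs T" using arcs_symmetric[OF xy(1)] .
    have ne: "x \<noteq> y" using xy(1) no_loops' by blast
    have "2 \<le> length p"
    proof (rule ccontr)
      assume "\<not> 2 \<le> length p"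
      then have "p = [] \<or> (\<exists>e. p = [e])" by (cases p; cases "tl p") auto
      then show False
        using p ne by (auto simp: apath_def awalk_def)
    qed
    moreover have "awalk y ((y, x) # p) y" "distinct (tl (awalk_verts y ((y, x) # p)))"
      using p(1) yx by (auto simp: apath_def awalk_Cons_iff)
    ultimately show "\<exists>p. cycle p \<and> 3 \<le> length p"
      unfolding cycle_def by (intro exI[of _ "(y, x) # p"]) auto
  qed
qed

lemma num_acyclic_eq:
  assumes "pair_graph G"
  shows "num_acyclic G = card (acyc_orients (parcs G))"
  unfolding num_acyclic_def
proof (rule card_eq_card_arc_sets)
  interpret pair_graph G by fact
  fix D
  have "pair_wf_digraph D" if "D \<in> orientations G"
    using that wellformed' by unfold_locales (auto simp: orientations_def)
  then show "D \<in> acyclic_orientations G \<longleftrightarrow> pverts D = pverts G \<and> parcs D \<in> acyc_orients (parcs G)"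
    using ex_cycle_iff[of D]
    by (auto simp: acyclic_orientations_def orientations_def acyc_orients_iff_acyclic orientation_of_def)
qed

lemma num_totally_cyclic_eq:
  assumes "pair_graph G"
  shows "num_totally_cyclic G = card (totcyc_orients (parcs G))"
  unfolding num_totally_cyclic_def
proof (rule card_eq_card_arc_sets)
  interpret pair_graph G by fact
  fix D
  have "pair_wf_digraph D" if "D \<in> orientations G"
    using that wellformed' by unfold_locales (auto simp: orientations_def)
  then have "D \<in> orientations G \<Longrightarrow>
      (\<forall>e \<in> parcs D. \<exists>p. pre_digraph.cycle (with_proj D) p \<and> e \<in> set p) \<longleftrightarrow>
      (\<forall>(x, y) \<in> parcs D. (y, x) \<in> (parcs D)\<^sup>*)"
    using arc_on_cycle_iff[of D] by fast
  then have "D \<in> totally_cyclic_orientations G \<longleftrightarrow>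
      D \<in> orientations G \<and> (\<forall>(x, y) \<in> parcs D. (y, x) \<in> (parcs D)\<^sup>*)"
    unfolding totally_cyclic_orientations_def by blast
  then show "D \<in> totally_cyclic_orientations G \<longleftrightarrow> pverts D = pverts G \<and> parcs D \<in> totcyc_orients (parcs G)"
    by (simp add: orientations_def totcyc_orients_def orientation_of_def)
qed

lemma num_spanning_trees_eq:
  assumes "pair_graph G" "pverts G \<noteq> {}"
  shows "num_spanning_trees G = card (span_trees (pverts G) (parcs G))"
  unfolding num_spanning_trees_def
proof (rule card_eq_card_arc_sets)
  interpret pair_graph G by fact
  fix T
  have conn: "connected (with_proj T) \<longleftrightarrow> pverts T \<times> pverts T \<subseteq> (parcs T)\<^sup>*"
    if T: "pair_graph T" and "pverts T = pverts G"
  proof -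
    interpret T: pair_graph T by fact
    have "connected (with_proj T) \<longleftrightarrow> strongly_connected (with_proj T)"
      by (simp add: Digraph_Component.connected_def strongly_connected_def
          T.reachable_mk_symmetric_eq[OF T.sym_arcs])
    then show ?thesis
      using that assms(2) T.reachable_conv' by (auto simp: strongly_connected_def)
  qed
  have wfG: "wf_digraph (with_proj G)" ..
  show "T \<in> spanning_trees G \<longleftrightarrow> pverts T = pverts G \<and> parcs T \<in> span_trees (pverts G) (parcs G)"
  proof
    assume "T \<in> spanning_trees G"
    then have T: "pair_graph T" "pverts T = pverts G" "parcs T \<subseteq> parcs G" "connected (with_proj T)"
      "\<not> (\<exists>p. pre_digraph.cycle (with_proj T) p \<and> 3 \<le> length p)"
      by (auto simp: spanning_trees_def spanning_def subgraph_def)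
    interpret T: pair_graph T by fact
    have "sym (parcs T)" using T.arcs_symmetric by (auto simp: sym_def)
    then show "pverts T = pverts G \<and> parcs T \<in> span_trees (pverts G) (parcs G)"
      using T conn ex_undirected_cycle_iff[OF T(1)] by (auto simp: span_trees_def)
  next
    assume T: "pverts T = pverts G \<and> parcs T \<in> span_trees (pverts G) (parcs G)"
    then have sub: "parcs T \<subseteq> parcs G" and sym: "sym (parcs T)" by (auto simp: span_trees_def)
    have pg: "pair_graph T"
    proof unfold_locales
      show "finite (parcs T)" "finite (pverts T)"
        using T sub pair_finite_arcs pair_finite_verts by (auto intro: finite_subset)
      show "symmetric (with_proj T)" using sym by (simp add: symmetric_def)
    qed (use T sub wellformed' no_loops' in fastforce)+
    interpret T: pair_graph T by fact
    have "wf_digraph (with_proj T)" ..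
    then have "spanning (with_proj T) (with_proj G)"
      using T sub wfG by (auto simp: spanning_def subgraph_def compatible_def)
    moreover have "connected (with_proj T)" using conn[OF pg] T by (auto simp: span_trees_def)
    moreover have "\<not> (\<exists>p. pre_digraph.cycle (with_proj T) p \<and> 3 \<le> length p)"
      using ex_undirected_cycle_iff[OF pg] T by (auto simp: span_trees_def)
    ultimately show "T \<in> spanning_trees G" using pg by (simp add: spanning_trees_def)
  qed
qed

lemma Q_eq_Q_rel:
  assumes "pair_graph G" "pverts G \<noteq> {}"
  shows "Q G = Q_rel (pverts G) (parcs G)"
  using assms by (simp add: Q_def Q_rel_def num_acyclic_eq num_totally_cyclic_eq num_spanning_trees_eq)

section \<open>Invariance under isomorphism\<close>

abbreviation map_arcs :: "('a \<Rightarrow> 'b) \<Rightarrow> 'a rel \<Rightarrow> 'b rel" where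
  "map_arcs f R \<equiv> map_prod f f ` R"

lemma rtrancl_map_arcs: "(x, y) \<in> R\<^sup>* \<Longrightarrow> (f x, f y) \<in> (map_arcs f R)\<^sup>*"
proof (induction rule: rtrancl_induct)
  case (step y z)
  then have "(f y, f z) \<in> map_arcs f R" by force
  then show ?case using step.IH by (rule rtrancl_into_rtrancl[rotated])
qed simp

text \<open>
  The converse direction is the forward direction for the inverse of \<open>f\<close> on \<open>V\<close>.
\<close>

lemma rtrancl_map_arcs_iff:
  assumes "inj_on f V" "R \<subseteq> V \<times> V" "x \<in> V" "y \<in> V"
  shows "(f x, f y) \<in> (map_arcs f R)\<^sup>* \<longleftrightarrow> (x, y) \<in> R\<^sup>*"
proof
  let ?g = "inv_into V f"
  assume "(f x, f y) \<in> (map_arcs f R)\<^sup>*"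
  then have "(?g (f x), ?g (f y)) \<in> (map_arcs ?g (map_arcs f R))\<^sup>*" by (rule rtrancl_map_arcs)
  moreover have "map_arcs ?g (map_arcs f R) = R"
  proof -
    have "map_prod ?g ?g (map_prod f f p) = p" if "p \<in> R" for p
      using that assms by (cases p) auto
    then show ?thesis by (simp add: image_image)
  qed
  ultimately show "(x, y) \<in> R\<^sup>*" using assms by simp
qed (rule rtrancl_map_arcs)

lemma map_arcs_iff:
  assumes "inj_on f V" "R \<subseteq> V \<times> V" "x \<in> V" "y \<in> V"
  shows "(f x, f y) \<in> map_arcs f R \<longleftrightarrow> (x, y) \<in> R"
proof
  assume "(f x, f y) \<in> map_arcs f R"
  then obtain x' y' where xy: "(x', y') \<in> R" "f x = f x'" "f y = f y'" by auto
  then have "x' \<in> V" "y' \<in> V" using assms(2) by auto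
  then have "x = x'" "y = y'" using xy assms by (auto dest: inj_onD)
  then show "(x, y) \<in> R" using xy(1) by simp
qed force

lemma ball_map_arcs:
  "(\<forall>(p, q) \<in> map_arcs f R. P p q) \<longleftrightarrow> (\<forall>(x, y) \<in> R. P (f x) (f y))"
  by auto

lemma ball_arcs_cong:
  assumes "\<And>x y. (x, y) \<in> R \<Longrightarrow> P x y = P' x y"
  shows "(\<forall>(x, y) \<in> R. P x y) = (\<forall>(x, y) \<in> R. P' x y)"
  using assms by fast

lemma sym_iff_ball: "sym R \<longleftrightarrow> (\<forall>(x, y) \<in> R. (y, x) \<in> R)"
  by (auto simp: sym_def)

lemma card_map_arcs:
  assumes inj: "inj_on f V" and E: "E \<subseteq> V \<times> V"
    and "X \<subseteq> Pow E" "Y \<subseteq> Pow (map_arcs f E)"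
    and iff: "\<And>D. D \<subseteq> E \<Longrightarrow> map_arcs f D \<in> Y \<longleftrightarrow> D \<in> X"
  shows "card Y = card X"
proof -
  have "Y = map_arcs f ` X"
    using assms(3,4) iff by (auto elim!: subset_imageE)
  moreover have "inj_on (map_prod f f) (V \<times> V)"
    using inj by (simp add: map_prod_inj_on)
  then have "inj_on (map_arcs f) X"
    using assms(3) E by (meson PowD inj_on_image_Pow inj_on_subset Pow_mono subset_trans)
  ultimately show ?thesis by (simp add: card_image)
qed

lemma Q_rel_map_arcs:
  assumes inj: "inj_on f V" and E: "E \<subseteq> V \<times> V"
  shows "Q_rel (f ` V) (map_arcs f E) = Q_rel V E"
proof -
  have DV: "D \<subseteq> V \<times> V" if "D \<subseteq> E" for D using that E by blast
  have orient: "orientation_of (map_arcs f E) (map_arcs f D) \<longleftrightarrow> orientation_of E D"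
    if D: "D \<subseteq> E" for D
  proof -
    have "((f x, f y) \<in> map_arcs f D) \<noteq> ((f y, f x) \<in> map_arcs f D) \<longleftrightarrow>
        ((x, y) \<in> D) \<noteq> ((y, x) \<in> D)" if "(x, y) \<in> E" for x y
    proof -
      have "x \<in> V" "y \<in> V" using that E by auto
      then show ?thesis by (simp only: map_arcs_iff[OF inj DV[OF D]])
    qed
    then have "(\<forall>(x, y) \<in> E. ((f x, f y) \<in> map_arcs f D) \<noteq> ((f y, f x) \<in> map_arcs f D)) \<longleftrightarrow>
        (\<forall>(x, y) \<in> E. ((x, y) \<in> D) \<noteq> ((y, x) \<in> D))" by (rule ball_arcs_cong)
    then show ?thesis
      unfolding orientation_of_def ball_map_arcs using D by (simp add: image_mono)
  qed
  have reach: "(f x, f y) \<in> (map_arcs f D)\<^sup>* \<longleftrightarrow> (x, y) \<in> D\<^sup>*"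
    if "D \<subseteq> E" "x \<in> V" "y \<in> V" for D x y
    using rtrancl_map_arcs_iff[OF inj DV] that by blast
  have return_iff: "(\<forall>(x, y) \<in> map_arcs f D. P ((y, x) \<in> (map_arcs f D)\<^sup>*)) \<longleftrightarrow>
      (\<forall>(x, y) \<in> D. P ((y, x) \<in> D\<^sup>*))" if D: "D \<subseteq> E" for D P
  proof -
    have "(f y, f x) \<in> (map_arcs f D)\<^sup>* \<longleftrightarrow> (y, x) \<in> D\<^sup>*" if "(x, y) \<in> D" for x y
      using reach[OF D, of y x] DV[OF D] that by blast
    then have "P ((f y, f x) \<in> (map_arcs f D)\<^sup>*) = P ((y, x) \<in> D\<^sup>*)" if "(x, y) \<in> D" for x y
      using that by simp
    then show ?thesis unfolding ball_map_arcs by (rule ball_arcs_cong)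
  qed
  have "card (acyc_orients (map_arcs f E)) = card (acyc_orients E)"
  proof (rule card_map_arcs[OF inj E acyc_orients_subset_Pow acyc_orients_subset_Pow])
    show "map_arcs f D \<in> acyc_orients (map_arcs f E) \<longleftrightarrow> D \<in> acyc_orients E" if "D \<subseteq> E" for D
      unfolding acyc_orients_def mem_Collect_eq orient[OF that] return_iff[OF that] ..
  qed
  moreover have "card (totcyc_orients (map_arcs f E)) = card (totcyc_orients E)"
  proof (rule card_map_arcs[OF inj E totcyc_orients_subset_Pow totcyc_orients_subset_Pow])
    show "map_arcs f D \<in> totcyc_orients (map_arcs f E) \<longleftrightarrow> D \<in> totcyc_orients E" if "D \<subseteq> E" for D
      unfolding totcyc_orients_def mem_Collect_eq orient[OF that] return_iff[OF that, of "\<lambda>b. b"] ..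
  qed
  moreover have "card (span_trees (f ` V) (map_arcs f E)) = card (span_trees V E)"
  proof (rule card_map_arcs[OF inj E span_trees_subset_Pow span_trees_subset_Pow])
    fix R assume R: "R \<subseteq> E"
    have "sym (map_arcs f R) \<longleftrightarrow> sym R"
    proof -
      have "(f y, f x) \<in> map_arcs f R \<longleftrightarrow> (y, x) \<in> R" if "(x, y) \<in> R" for x y
        by (rule map_arcs_iff[OF inj DV[OF R]]) (use that DV[OF R] in auto)
      then show ?thesis unfolding sym_iff_ball ball_map_arcs by (rule ball_arcs_cong)
    qed
    moreover have "f ` V \<times> f ` V \<subseteq> (map_arcs f R)\<^sup>* \<longleftrightarrow> V \<times> V \<subseteq> R\<^sup>*"
    proof -
      have "f ` V \<times> f ` V \<subseteq> (map_arcs f R)\<^sup>* \<longleftrightarrow> (\<forall>x \<in> V. \<forall>y \<in> V. (f x, f y) \<in> (map_arcs f R)\<^sup>*)"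
        by (simp only: subset_iff split_paired_All mem_Sigma_iff) blast
      also have "\<dots> \<longleftrightarrow> (\<forall>x \<in> V. \<forall>y \<in> V. (x, y) \<in> R\<^sup>*)"
        by (simp only: reach[OF R] cong: ball_cong)
      finally show ?thesis by blast
    qed
    moreover have "(\<forall>(x, y) \<in> map_arcs f R. (x, y) \<notin> (map_arcs f R - arc_pair x y)\<^sup>*) \<longleftrightarrow>
      (\<forall>(x, y) \<in> R. (x, y) \<notin> (R - arc_pair x y)\<^sup>*)"
    proof -
      have del: "map_arcs f R - arc_pair (f x) (f y) = map_arcs f (R - arc_pair x y)"
        if "(x, y) \<in> R" for x y
      proof -
        have "inj_on (map_prod f f) (V \<times> V)" using inj by (simp add: map_prod_inj_on)
        moreover have "arc_pair x y \<subseteq> V \<times> V" using that DV[OF R] by auto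
        ultimately have "map_arcs f (R - arc_pair x y) = map_arcs f R - map_arcs f (arc_pair x y)"
          using DV[OF R] by (intro inj_on_image_set_diff) auto
        then show ?thesis by simp
      qed
      then have "(f x, f y) \<in> (map_arcs f R - arc_pair (f x) (f y))\<^sup>* \<longleftrightarrow> (x, y) \<in> (R - arc_pair x y)\<^sup>*"
        if "(x, y) \<in> R" for x y
      proof -
        have "x \<in> V" "y \<in> V" "R - arc_pair x y \<subseteq> E" using that DV[OF R] R by auto
        then show ?thesis by (simp only: del[OF that] reach)
      qed
      then have "(f x, f y) \<notin> (map_arcs f R - arc_pair (f x) (f y))\<^sup>* \<longleftrightarrow> (x, y) \<notin> (R - arc_pair x y)\<^sup>*"
        if "(x, y) \<in> R" for x y
        using that by simp
      then show ?thesis unfolding ball_map_arcs by (rule ball_arcs_cong)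
    qed
    ultimately show "map_arcs f R \<in> span_trees (f ` V) (map_arcs f E) \<longleftrightarrow> R \<in> span_trees V E"
      using R image_mono[OF R, of "map_prod f f"] unfolding span_trees_def mem_Collect_eq by simp
  qed
  ultimately show ?thesis by (simp add: Q_rel_def)
qed

section \<open>Complete bipartite graphs\<close>

text \<open>
  A connected subgraph with the least number of arcs is a tree, since an edge that is not a bridge
  could be removed.
\<close>

lemma ex_span_tree:
  assumes "finite E" "sym E" "V \<times> V \<subseteq> E\<^sup>*"
  shows "span_trees V E \<noteq> {}"
proof -
  define P where "P R \<longleftrightarrow> R \<subseteq> E \<and> sym R \<and> V \<times> V \<subseteq> R\<^sup>*" for R
  have "P E" using assms by (simp add: P_def)
  then obtain R where R: "P R" and min: "\<And>S. P S \<Longrightarrow> card R \<le> card S"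
    using ex_has_least_nat[of P E card] by blast
  have "(x, y) \<notin> (R - arc_pair x y)\<^sup>*" if xy: "(x, y) \<in> R" for x y
  proof
    let ?S = "R - arc_pair x y"
    assume reach: "(x, y) \<in> ?S\<^sup>*"
    have sym: "sym ?S" using R unfolding P_def sym_def by blast
    then have "(y, x) \<in> ?S\<^sup>*" using reach by (meson symD sym_rtrancl)
    then have "R \<subseteq> ?S\<^sup>*" using reach by auto
    then have "R\<^sup>* \<subseteq> ?S\<^sup>*" by (metis rtrancl_idemp rtrancl_mono)
    then have "P ?S" using R sym unfolding P_def by blast
    moreover have "card ?S < card R"
      using R xy assms(1) by (intro psubset_card_mono) (auto simp: P_def intro: finite_subset)
    ultimately show False using min by fastforce
  qed
  then have "R \<in> span_trees V E" using R by (auto simp: span_trees_def P_def)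
  then show ?thesis by blast
qed

definition cross_arcs :: "'a set \<Rightarrow> 'b set \<Rightarrow> ('a + 'b) rel" where
  "cross_arcs X Y = Inl ` X \<times> Inr ` Y \<union> Inr ` Y \<times> Inl ` X"

lemma Q_rel_cross_arcs_cong:
  assumes "finite X" "finite Y" "card X = a" "card Y = b"
  shows "Q_rel (X <+> Y) (cross_arcs X Y) = Q_rel ({..<a} <+> {..<b}) (cross_arcs {..<a} {..<b})"
proof -
  obtain g h where g: "bij_betw g X {..<a}" and h: "bij_betw h Y {..<b}"
    using assms by (metis atLeast0LessThan ex_bij_betw_finite_nat)
  let ?f = "map_sum g h"
  have "inj_on ?f (X <+> Y)"
    using bij_betw_imp_inj_on[OF g] bij_betw_imp_inj_on[OF h]
    by (intro inj_onI) (auto dest: inj_onD elim!: PlusE)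
  moreover have "cross_arcs X Y \<subseteq> (X <+> Y) \<times> (X <+> Y)" by (auto simp: cross_arcs_def)
  moreover have "?f ` (X <+> Y) = {..<a} <+> {..<b}"
  proof -
    have "?f ` (X <+> Y) = g ` X <+> h ` Y" by (simp add: Plus_def image_Un image_image)
    then show ?thesis using g h by (simp add: bij_betw_def)
  qed
  moreover have "map_arcs ?f (cross_arcs X Y) = cross_arcs {..<a} {..<b}"
  proof -
    have "map_arcs ?f (cross_arcs X Y) = cross_arcs (g ` X) (h ` Y)"
      unfolding cross_arcs_def by (force simp: image_iff)
    then show ?thesis using g h by (simp add: bij_betw_def)
  qed
  ultimately show ?thesis using Q_rel_map_arcs by metis
qed

lemma acyc_orients_cross_arcs: "acyc_orients (cross_arcs X Y) \<noteq> {}"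
proof -
  let ?D = "Inl ` X \<times> Inr ` Y"
  have "(Inr y, Inl x) \<notin> ?D\<^sup>*" for x y by (auto elim: converse_rtranclE)
  then have "?D \<in> acyc_orients (cross_arcs X Y)"
    by (auto simp: acyc_orients_def orientation_of_def cross_arcs_def)
  then show ?thesis by blast
qed

lemma totcyc_orients_cross_arcs:
  assumes x: "x0 \<in> X" "x1 \<in> X" "x0 \<noteq> x1" and y: "y0 \<in> Y" "y1 \<in> Y" "y0 \<noteq> y1"
  shows "totcyc_orients (cross_arcs X Y) \<noteq> {}"
proof -
  \<comment> \<open>Every arc goes one step around the cyclic sequence \<open>x0\<close>, all \<open>y \<noteq> y0\<close>, all \<open>x \<noteq> x0\<close>, \<open>y0\<close>, so
    three further steps lead back.\<close>
  define D where "D = {(Inl x, Inr y) | x y. x \<in> X \<and> y \<in> Y \<and> (x = x0) \<noteq> (y = y0)} \<union>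
    {(Inr y, Inl x) | x y. x \<in> X \<and> y \<in> Y \<and> (x = x0) = (y = y0)}"
  have "orientation_of (cross_arcs X Y) D"
    by (auto simp: orientation_of_def cross_arcs_def D_def)
  moreover have three: "(p, s) \<in> D\<^sup>*" if "(p, q) \<in> D" "(q, r) \<in> D" "(r, s) \<in> D" for p q r s
    using that by (meson converse_rtrancl_into_rtrancl rtrancl.rtrancl_refl)
  have "(Inr y, Inl x) \<in> D\<^sup>*" if "(Inl x, Inr y) \<in> D" for x y
  proof (cases "x = x0")
    case True
    then show ?thesis
      by (intro three[of _ "Inl x1" "Inr y0"]) (use that x y in \<open>auto simp: D_def\<close>)
  next
    case False
    then show ?thesis
      by (intro three[of _ "Inl x0" "Inr y1"]) (use that x y in \<open>auto simp: D_def\<close>)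
  qed
  moreover have "(Inl x, Inr y) \<in> D\<^sup>*" if "(Inr y, Inl x) \<in> D" for x y
  proof (cases "x = x0")
    case True
    then show ?thesis
      by (intro three[of _ "Inr y1" "Inl x1"]) (use that x y in \<open>auto simp: D_def\<close>)
  next
    case False
    then show ?thesis
      by (intro three[of _ "Inr y0" "Inl x0"]) (use that x y in \<open>auto simp: D_def\<close>)
  qed
  moreover have "(\<exists>x y. p = Inl x \<and> q = Inr y) \<or> (\<exists>x y. p = Inr y \<and> q = Inl x)" if "(p, q) \<in> D" for p q
    using that by (auto simp: D_def)
  ultimately have "D \<in> totcyc_orients (cross_arcs X Y)" unfolding totcyc_orients_def by blast
  then show ?thesis by blast
qed

lemma connected_cross_arcs:
  assumes "x0 \<in> X" "y0 \<in> Y"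
  shows "(X <+> Y) \<times> (X <+> Y) \<subseteq> (cross_arcs X Y)\<^sup>*"
proof -
  have "sym (cross_arcs X Y)" by (auto simp: sym_def cross_arcs_def)
  then have sym: "sym ((cross_arcs X Y)\<^sup>*)" by (rule sym_rtrancl)
  have "(v, Inl x0) \<in> (cross_arcs X Y)\<^sup>*" if "v \<in> X <+> Y" for v
  proof (cases v)
    case (Inl x)
    then have "(v, Inr y0) \<in> cross_arcs X Y" "(Inr y0, Inl x0) \<in> cross_arcs X Y"
      using that assms by (auto simp: cross_arcs_def)
    then show ?thesis by (meson converse_rtrancl_into_rtrancl rtrancl.rtrancl_refl)
  next
    case (Inr y)
    then have "(v, Inl x0) \<in> cross_arcs X Y" using that assms by (auto simp: cross_arcs_def)
    then show ?thesis by blast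
  qed
  then have "(v, w) \<in> (cross_arcs X Y)\<^sup>*" if "v \<in> X <+> Y" "w \<in> X <+> Y" for v w
    using that sym by (meson rtrancl_trans symD)
  then show ?thesis by blast
qed

lemma two_distinct_elements:
  assumes "2 \<le> card X"
  obtains x y where "x \<in> X" "y \<in> X" "x \<noteq> y"
proof -
  obtain S where "S \<subseteq> X" "card S = 2" using obtain_subset_with_card_n[OF assms] by blast
  then show ?thesis using that by (auto simp: card_2_iff)
qed

lemma Q_rel_cross_arcs_pos:
  assumes "finite X" "finite Y" "2 \<le> card X" "2 \<le> card Y"
  shows "0 < Q_rel (X <+> Y) (cross_arcs X Y)"
proof -
  obtain x0 x1 where x: "x0 \<in> X" "x1 \<in> X" "x0 \<noteq> x1"
    using two_distinct_elements[OF assms(3)] .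
  obtain y0 y1 where y: "y0 \<in> Y" "y1 \<in> Y" "y0 \<noteq> y1"
    using two_distinct_elements[OF assms(4)] .
  have fin: "finite (cross_arcs X Y)" using assms by (simp add: cross_arcs_def)
  have "sym (cross_arcs X Y)" by (auto simp: sym_def cross_arcs_def)
  then have "span_trees (X <+> Y) (cross_arcs X Y) \<noteq> {}"
    using fin x(1) y(1) by (intro ex_span_tree connected_cross_arcs)
  then show ?thesis
    using fin acyc_orients_cross_arcs[of X Y] totcyc_orients_cross_arcs[OF x y]
    by (auto simp: Q_rel_def card_gt_0_iff finite_acyc_orients finite_totcyc_orients finite_span_trees)
qed

lemma Q_complete_bipartite:
  assumes "0 < a"
  shows "Q (complete_bipartite a b) = Q_rel ({..<a} <+> {..<b}) (cross_arcs {..<a} {..<b})"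
proof -
  have "pair_graph (complete_bipartite a b)"
    by unfold_locales (auto simp: complete_bipartite_def symmetric_def sym_def)
  moreover have "pverts (complete_bipartite a b) \<noteq> {}"
    using assms by (auto simp: complete_bipartite_def Plus_def)
  ultimately show ?thesis
    by (simp add: Q_eq_Q_rel) (simp add: complete_bipartite_def cross_arcs_def)
qed

section \<open>Joins\<close>

lemma edges_eq_edges_of: "edges G = edges_of (parcs G)"
  by (auto simp: edges_def edges_of_def)

lemma card_edges_of_map_arcs:
  assumes "inj f"
  shows "card (edges_of (map_arcs f N)) = card (edges_of N)"
proof -
  have "edges_of (map_arcs f N) = (`) f ` edges_of N"
    unfolding edges_of_def image_image by (intro image_cong) auto
  moreover have "inj_on ((`) f) (edges_of N)" using assms by (intro inj_on_image) (auto intro: inj_on_subset)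
  ultimately show ?thesis by (simp add: card_image)
qed

text \<open>
  The edges of \<open>A\<close> are added first; this does not change the neighbours of the vertices of \<open>B\<close>,
  so the ends of an edge of \<open>B\<close> still have exactly the vertices of \<open>A\<close> in common.
\<close>

lemma Q_join_ge:
  assumes A: "pair_graph A" and B: "pair_graph B"
    and a: "card (pverts A) = a" and b: "card (pverts B) = b" and "1 \<le> a" "1 \<le> b"
  shows "Q_rel (pverts A <+> pverts B) (cross_arcs (pverts A) (pverts B))
    * eta b ^ num_edges A * eta a ^ num_edges B \<le> Q (join A B)"
proof -
  interpret A: pair_graph A by (fact A)
  interpret B: pair_graph B by (fact B)
  let ?X = "pverts A" and ?Y = "pverts B"
  let ?V = "?X <+> ?Y" and ?K = "cross_arcs ?X ?Y"
  let ?M = "map_arcs Inl (parcs A) :: ('a + 'b) rel" and ?N = "map_arcs Inr (parcs B) :: ('a + 'b) rel"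
  have fin: "finite ?K" "finite ?M" "finite ?N"
    using A.pair_finite_verts A.pair_finite_arcs B.pair_finite_verts B.pair_finite_arcs
    by (simp_all add: cross_arcs_def)
  have sym: "sym ?K" "sym ?M" "sym ?N"
    using A.arcs_symmetric B.arcs_symmetric by (force simp: sym_def cross_arcs_def)+
  have irrefl: "irrefl ?M" "irrefl ?N"
    using A.no_loops' B.no_loops' by (auto simp: irrefl_def)
  have V: "?K \<subseteq> ?V \<times> ?V" "?M \<subseteq> ?V \<times> ?V" "?N \<subseteq> ?V \<times> ?V"
    using A.wellformed' B.wellformed' by (auto simp: cross_arcs_def)
  have disj: "?K \<inter> ?M = {}" "(?K \<union> ?M) \<inter> ?N = {}" by (auto simp: cross_arcs_def)
  have common_M: "card {w. (x, w) \<in> ?K \<and> (y, w) \<in> ?K} = b" if "(x, y) \<in> ?M" for x y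
  proof -
    have "{w. (x, w) \<in> ?K \<and> (y, w) \<in> ?K} = Inr ` ?Y"
      using that A.wellformed' by (auto simp: cross_arcs_def)
    then show ?thesis using b by (simp add: card_image)
  qed
  have common_N: "card {w. (x, w) \<in> ?K \<union> ?M \<and> (y, w) \<in> ?K \<union> ?M} = a" if "(x, y) \<in> ?N" for x y
  proof -
    have "{w. (x, w) \<in> ?K \<union> ?M \<and> (y, w) \<in> ?K \<union> ?M} = Inl ` ?X"
      using that B.wellformed' by (auto simp: cross_arcs_def)
    then show ?thesis using a by (simp add: card_image)
  qed
  have "Q_rel ?V ?K * eta b ^ card (edges_of ?M) \<le> Q_rel ?V (?K \<union> ?M)"
    by (rule Q_rel_add_edges)
      (use fin sym irrefl V disj common_M \<open>1 \<le> b\<close> in auto)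
  then have M: "Q_rel ?V ?K * eta b ^ num_edges A \<le> Q_rel ?V (?K \<union> ?M)"
    by (simp add: card_edges_of_map_arcs num_edges_def edges_eq_edges_of)
  have "Q_rel ?V (?K \<union> ?M) * eta a ^ card (edges_of ?N) \<le> Q_rel ?V (?K \<union> ?M \<union> ?N)"
    by (rule Q_rel_add_edges)
      (use fin sym irrefl V disj common_N \<open>1 \<le> a\<close> in \<open>auto simp: sym_Un\<close>)
  then have N: "Q_rel ?V (?K \<union> ?M) * eta a ^ num_edges B \<le> Q_rel ?V (?K \<union> ?M \<union> ?N)"
    by (simp add: card_edges_of_map_arcs num_edges_def edges_eq_edges_of)
  have J: "pverts (join A B) = ?V" "parcs (join A B) = ?K \<union> ?M \<union> ?N"
    by (auto simp: join_def cross_arcs_def)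
  have "?X \<noteq> {}" using a \<open>1 \<le> a\<close> by auto
  then have "Q (join A B) = Q_rel ?V (?K \<union> ?M \<union> ?N)"
    using Q_eq_Q_rel[OF pair_graph_join[OF A B]] J by (simp add: Plus_def)
  moreover have "Q_rel ?V ?K * eta b ^ num_edges A * eta a ^ num_edges B
      \<le> Q_rel ?V (?K \<union> ?M) * eta a ^ num_edges B"
    using M by (rule mult_right_mono) (simp add: eta_nonneg)
  ultimately show ?thesis using N by simp
qed

lemma Q_join_edgeless:
  assumes "pair_graph A" "pair_graph B" "edges A = {}" "edges B = {}" "pverts A \<noteq> {}"
  shows "Q (join A B) = Q_rel (pverts A <+> pverts B) (cross_arcs (pverts A) (pverts B))"
proof -
  have "parcs A = {}" "parcs B = {}" using assms(3,4) by (auto simp: edges_eq_edges_of edges_of_def)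
  then have "pverts (join A B) = pverts A <+> pverts B"
    "parcs (join A B) = cross_arcs (pverts A) (pverts B)"
    by (simp_all add: join_def cross_arcs_def)
  then show ?thesis
    using Q_eq_Q_rel[OF pair_graph_join[OF assms(1,2)]] assms(5) by (simp add: Plus_def)
qed

text \<open>
  With \<open>5 / 7\<close> as the square root of \<open>25 / 49\<close>, the claim is \<open>s / (s + 2) \<ge> 5 / 7\<close>, and equality holds at
  \<open>s = 5\<close>.
\<close>

lemma eta_ge:
  assumes "5 \<le> s"
  shows "50 / 49 \<le> eta s"
proof -
  have "5 * (real s + 2) \<le> 7 * real s" using assms by simp
  then have "(5 * (real s + 2))\<^sup>2 \<le> (7 * real s)\<^sup>2" by (intro power_mono) auto
  then have "25 * (real s + 2)\<^sup>2 \<le> 49 * (real s)\<^sup>2" by (simp only: power_mult_distrib) simp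
  then show ?thesis by (simp add: eta_def divide_simps)
qed

theorem theorem1p2:
  fixes A :: "'a pair_pre_digraph" and B :: "'b pair_pre_digraph" and a b :: nat
  assumes "pair_graph A" and "pair_graph B"
    and "card (pverts A) = a" and "card (pverts B) = b"
    and "a \<ge> 2" and "b \<ge> 2"
  shows "Q (join A B) \<ge> Q (complete_bipartite a b) * eta b ^ num_edges A * eta a ^ num_edges B
    \<and> (a \<ge> 5 \<and> b \<ge> 5 \<longrightarrow>
        Q (join A B) \<ge> Q (complete_bipartite a b) * (50 / 49) ^ (num_edges A + num_edges B)
      \<and> Q (join A B) \<ge> Q (complete_bipartite a b)
      \<and> (Q (join A B) = Q (complete_bipartite a b) \<longleftrightarrow> edges A = {} \<and> edges B = {}))"
proof -
  interpret A: pair_graph A by fact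
  interpret B: pair_graph B by fact
  let ?K = "Q (complete_bipartite a b)" and ?n = "num_edges A + num_edges B"
  have K: "?K = Q_rel (pverts A <+> pverts B) (cross_arcs (pverts A) (pverts B))"
    using assms(5) Q_complete_bipartite[of a b]
      Q_rel_cross_arcs_cong[OF A.pair_finite_verts B.pair_finite_verts assms(3,4)] by simp
  have pos: "0 < ?K"
    unfolding K using assms A.pair_finite_verts B.pair_finite_verts
    by (intro Q_rel_cross_arcs_pos) auto
  have main: "?K * eta b ^ num_edges A * eta a ^ num_edges B \<le> Q (join A B)"
    unfolding K using assms by (intro Q_join_ge) auto
  moreover have "?K * (50 / 49) ^ ?n \<le> Q (join A B) \<and> ?K \<le> Q (join A B)
      \<and> (Q (join A B) = ?K \<longleftrightarrow> edges A = {} \<and> edges B = {})" if "5 \<le> a" "5 \<le> b"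
  proof -
    have "(50 / 49) ^ ?n \<le> eta b ^ num_edges A * eta a ^ num_edges B"
      unfolding power_add using eta_ge that
      by (intro mult_mono power_mono) (auto simp: eta_nonneg)
    then have "?K * (50 / 49) ^ ?n \<le> ?K * (eta b ^ num_edges A * eta a ^ num_edges B)"
      using pos by (intro mult_left_mono) auto
    then have ge: "?K * (50 / 49) ^ ?n \<le> Q (join A B)" using main by (simp add: mult.assoc)
    have "?K * 1 \<le> ?K * (50 / 49) ^ ?n"
      using pos by (intro mult_left_mono one_le_power) auto
    then have "?K \<le> Q (join A B)" using ge by simp
    moreover have "edges A = {} \<and> edges B = {}" if eq: "Q (join A B) = ?K"
    proof -
      have "(50 / 49 :: real) ^ ?n \<le> 1" using ge pos eq by simp
      then have "\<not> 0 < ?n" using one_less_power[of "50 / 49 :: real" ?n] by linarith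
      then have "?n = 0" by blast
      moreover have "finite (edges A)" "finite (edges B)"
        using A.pair_finite_arcs B.pair_finite_arcs by (simp_all add: edges_eq_edges_of edges_of_def)
      ultimately show ?thesis by (simp add: num_edges_def)
    qed
    moreover have "Q (join A B) = ?K" if "edges A = {}" "edges B = {}"
    proof -
      have "pverts A \<noteq> {}" using assms(3,5) by auto
      then show ?thesis unfolding K by (rule Q_join_edgeless[OF assms(1,2) that])
    qed
    ultimately show ?thesis using ge by blast
  qed
  ultimately show ?thesis by blast
qed

end
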